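(* Let $1\le k\le n$, $t\ge0$, $q_2\in[0,1]$. Start a deck of $n$ distinct cards in the order $1,2,\dots,n$ from top to bottom. After $t$ top-to-random shuffles (resp. $t$ binomial-top-to-random shuffles with parameter $q_2$), the distribution on $\mathfrak S_k$ of the standardisation of the values of the bottommost $k$ cards (read top to bottom) equals the distribution of a deck of $k$ cards, started in order $1,\dots,k$, after $t$ steps of the $\frac{n-k}{n}$-lazy version of the top-to-random shuffle (resp. after $t$ binomial-top-to-random shuffles with the same parameter $q_2$).
   Context: A deck is recorded as the sequence $w_1\cdots w_n$ of card values from top to bottom. Top-to-random shuffle: remove the top card and reinsert it at one of the $n$ positions chosen uniformly. Binomial-top-to-random shuffle with parameter $q_2$: choose $r\sim\mathrm{Binomial}(n,1-q_2)$, remove the top $r$ cards and reinsert them so that the resulting deck is uniform among the $n!/(n-r)!$ arrangements in which the other $n-r$ cards keep their relative order. Standardisation of a string of distinct numbers replaces its letters by $1,2,\dots$ preserving relative order. The $\alpha$-lazy version of a chain with transition matrix $K$ has transition matrix $\alpha\,\mathrm{id}+(1-\alpha)K$. *)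

theory Defs
  imports "HOL-Probability.Probability" "HOL-Library.Sublist"
begin

text \<open>A deck is the list of its card values, top card first; the arguments are meant to be
  lists of distinct values.  A Markov chain is given by its kernel
  \<open>K :: 'a \<Rightarrow> 'a pmf\<close>, where \<open>K x\<close> is the row of the transition matrix at \<open>x\<close>.\<close>

definition top_to_random :: "'a list \<Rightarrow> 'a list pmf" where
  "top_to_random w =
     map_pmf (\<lambda>i. take i (tl w) @ hd w # drop i (tl w)) (pmf_of_set {..<length w})"

definition binomial_top_to_random :: "real \<Rightarrow> 'a list \<Rightarrow> 'a list pmf" where
  "binomial_top_to_random q w =
     bind_pmf (binomial_pmf (length w) (1 - q))
       (\<lambda>r. pmf_of_set {v. mset v = mset w \<and> subseq (drop r w) v})"

definition lazy_chain :: "real \<Rightarrow> ('a \<Rightarrow> 'a pmf) \<Rightarrow> 'a \<Rightarrow> 'a pmf" where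
  "lazy_chain \<alpha> K x =
     bind_pmf (bernoulli_pmf \<alpha>) (\<lambda>stay. if stay then return_pmf x else K x)"

lemma pmf_lazy_chain:
  assumes "0 \<le> \<alpha>" "\<alpha> \<le> 1"
  shows "pmf (lazy_chain \<alpha> K x) y = \<alpha> * of_bool (x = y) + (1 - \<alpha>) * pmf (K x) y"
  using assms by (simp add: lazy_chain_def pmf_bind)

definition run_chain :: "('a \<Rightarrow> 'a pmf) \<Rightarrow> nat \<Rightarrow> 'a \<Rightarrow> 'a pmf" where
  "run_chain K t x = ((\<lambda>p. bind_pmf p K) ^^ t) (return_pmf x)"

definition standardise :: "'a::linorder list \<Rightarrow> nat list" where
  "standardise w = map (\<lambda>x. card {y \<in> set w. y \<le> x}) w"

definition bottommost :: "nat \<Rightarrow> 'a list \<Rightarrow> 'a list" where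
  "bottommost k w = drop (length w - k) w"

end

theory Submission
  imports Defs
begin

text \<open>The bottom \<open>k\<close> cards alone are not a lumping of the shuffle, because the value of the top
  card matters.  The inverse walk does lump.  A shuffle \<open>K\<close> permutes positions, so it commutes with
  every chain that relabels values.  Let \<open>V\<close> be the relabelling chain with \<open>V id = K id\<close>; then \<open>K\<close>
  and \<open>V\<close> have the same law at every time when started at \<open>id\<close>.  For both shuffles a step of \<open>V\<close>
  makes a random list \<open>xs\<close> of values the smallest ones, in the order of \<open>xs\<close>: a single uniform value
  for top-to-random, a uniformly ordered Bernoulli subset for binomial-top-to-random.  The effect on
  the relative order of \<open>k\<close> positions depends only on the part of \<open>xs\<close> lying in the set of their
  values, and this part has the law belonging to \<open>k\<close> cards (it is empty with probability
  \<open>(n - k) / n\<close> in the first case).\<close>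

section \<open>Lumping and commuting chains\<close>

lemma run_chain_0 [simp]: "run_chain K 0 x = return_pmf x"
  by (simp add: run_chain_def)

lemma run_chain_Suc [simp]: "run_chain K (Suc t) x = bind_pmf (run_chain K t x) K"
  by (simp add: run_chain_def)

lemma set_run_chain:
  assumes "\<And>y. y \<in> S \<Longrightarrow> set_pmf (K y) \<subseteq> S" "x \<in> S"
  shows "set_pmf (run_chain K t x) \<subseteq> S"
proof (induction t)
  case (Suc t)
  then show ?case using assms(1) by fastforce
qed (use assms(2) in simp)

text \<open>Strong lumpability: the law of \<phi> after one step depends on \<open>y\<close> only
  through \<open>\<phi> y\<close>, so the projected chain is again Markov with kernel
  \<open>L\<close>. The closed set \<open>S\<close> is there because the lumping identity will be
  proved for genuine decks only.\<close>

lemma map_pmf_run_chain: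
  assumes inv: "\<And>y. y \<in> S \<Longrightarrow> set_pmf (K y) \<subseteq> S"
    and lump: "\<And>y. y \<in> S \<Longrightarrow> map_pmf \<phi> (K y) = L (\<phi> y)"
    and x: "x \<in> S"
  shows "map_pmf \<phi> (run_chain K t x) = run_chain L t (\<phi> x)"
proof (induction t)
  case (Suc t)
  have "map_pmf \<phi> (run_chain K (Suc t) x) = bind_pmf (run_chain K t x) (\<lambda>y. map_pmf \<phi> (K y))"
    by (simp add: map_bind_pmf)
  also have "\<dots> = bind_pmf (run_chain K t x) (\<lambda>y. L (\<phi> y))"
    using set_run_chain[of S K x t, OF inv x] lump by (intro bind_pmf_cong) auto
  also have "\<dots> = bind_pmf (map_pmf \<phi> (run_chain K t x)) L"
    by (simp add: bind_map_pmf)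
  finally show ?case by (simp add: Suc)
qed simp

text \<open>A \<open>K\<close> step after \<open>t\<close> steps of \<open>V\<close> can be moved
  back past all of them to time 0, where it acts on \<open>x\<close> and equals a \<open>V\<close>
  step. Hence the \<open>K\<close> steps can be replaced by \<open>V\<close> steps one after
  another.\<close>

lemma run_chain_eq_of_commute:
  assumes inv: "\<And>y. y \<in> S \<Longrightarrow> set_pmf (V y) \<subseteq> S"
    and comm: "\<And>y. y \<in> S \<Longrightarrow> bind_pmf (V y) K = bind_pmf (K y) V"
    and x: "x \<in> S" and start: "K x = V x"
  shows "run_chain K t x = run_chain V t x"
proof (induction t)
  case (Suc t)
  have *: "bind_pmf (run_chain V t x) K = bind_pmf (run_chain V t x) V" for t
  proof (induction t)
    case (Suc t)
    have "bind_pmf (run_chain V (Suc t) x) K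
        = bind_pmf (run_chain V t x) (\<lambda>y. bind_pmf (V y) K)"
      by (simp add: bind_assoc_pmf)
    also have "\<dots> = bind_pmf (run_chain V t x) (\<lambda>y. bind_pmf (K y) V)"
      using set_run_chain[of S V x t, OF inv x] comm
      by (intro bind_pmf_cong[OF refl comm]) auto
    also have "\<dots> = bind_pmf (bind_pmf (run_chain V t x) K) V"
      by (simp add: bind_assoc_pmf)
    finally show ?case by (simp add: Suc)
  qed (simp add: bind_return_pmf start)
  show ?case by (simp add: Suc *)
qed simp

section \<open>Standardisation\<close>

text \<open>The symmetric group in one-line notation; it serves as the closed set \<open>S\<close>
  of the chain lemmas.\<close>

definition decks :: "nat \<Rightarrow> nat list set" where
  "decks n = {w. distinct w \<and> set w = {1..n}}"

lemma identity_in_decks: "[1..<n + 1] \<in> decks n"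
  by (auto simp: decks_def)

lemma length_decks: "w \<in> decks n \<Longrightarrow> length w = n"
  using distinct_card[of w] by (simp add: decks_def)

lemma decks_mset_eq: "w \<in> decks n \<Longrightarrow> mset v = mset w \<Longrightarrow> v \<in> decks n"
  unfolding decks_def using mset_eq_imp_distinct_iff mset_eq_setD by blast

lemma decks_conv_mset: "v \<in> decks n \<longleftrightarrow> mset v = mset [1..<n + 1]"
proof
  assume "v \<in> decks n"
  then show "mset v = mset [1..<n + 1]"
    using identity_in_decks[of n] by (subst set_eq_iff_mset_eq_distinct[symmetric]) (auto simp: decks_def)
qed (use decks_mset_eq identity_in_decks in blast)

lemma standardise_map:
  assumes "inj_on g (set w)"
  shows "standardise (map g w) = map (\<lambda>x. card {y \<in> set w. g y \<le> g x}) w"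
proof -
  have "card {z \<in> g ` set w. z \<le> g x} = card {y \<in> set w. g y \<le> g x}" for x
  proof -
    have "{z \<in> g ` set w. z \<le> g x} = g ` {y \<in> set w. g y \<le> g x}" by auto
    then show ?thesis
      using assms by (simp add: card_image inj_on_subset)
  qed
  then show ?thesis by (simp add: standardise_def)
qed

text \<open>Standardisation sees a labelling only through the order it induces, so an awkward sort
  key may be exchanged for any other one with the same comparisons.\<close>

lemma standardise_map_cong:
  assumes "inj_on g (set w)" "inj_on h (set w)"
    and "\<And>x y. x \<in> set w \<Longrightarrow> y \<in> set w \<Longrightarrow> g x \<le> g y \<longleftrightarrow> h x \<le> h y"
  shows "standardise (map g w) = standardise (map h w)"
  unfolding standardise_map[OF assms(1)] standardise_map[OF assms(2)]
  using assms(3) by (auto intro!: arg_cong[where f = card])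

lemma card_le_iff:
  fixes A :: "'a::linorder set"
  assumes "finite A" "x \<in> A" "z \<in> A"
  shows "card {y \<in> A. y \<le> x} \<le> card {y \<in> A. y \<le> z} \<longleftrightarrow> x \<le> z"
proof
  assume "x \<le> z"
  then show "card {y \<in> A. y \<le> x} \<le> card {y \<in> A. y \<le> z}"
    using assms by (intro card_mono) auto
next
  assume *: "card {y \<in> A. y \<le> x} \<le> card {y \<in> A. y \<le> z}"
  show "x \<le> z"
  proof (rule ccontr)
    assume "\<not> x \<le> z"
    then have "{y \<in> A. y \<le> z} \<subset> {y \<in> A. y \<le> x}" using assms by auto
    then have "card {y \<in> A. y \<le> z} < card {y \<in> A. y \<le> x}"
      using assms by (intro psubset_card_mono) auto
    with * show False by simp
  qed
qed

lemma inj_on_card_le: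
  fixes A :: "'a::linorder set"
  assumes "finite A"
  shows "inj_on (\<lambda>x. card {y \<in> A. y \<le> x}) A"
proof (rule inj_onI)
  fix x y assume "x \<in> A" "y \<in> A" "card {z \<in> A. z \<le> x} = card {z \<in> A. z \<le> y}"
  then show "x = y"
    using card_le_iff[OF assms, of x y] card_le_iff[OF assms, of y x] by simp
qed

lemma bij_betw_card_le:
  fixes A :: "'a::linorder set"
  assumes "finite A"
  shows "bij_betw (\<lambda>x. card {y \<in> A. y \<le> x}) A {1..card A}"
proof -
  have "(\<lambda>x. card {y \<in> A. y \<le> x}) ` A \<subseteq> {1..card A}"
  proof safe
    fix x assume "x \<in> A"
    then have "{y \<in> A. y \<le> x} \<noteq> {}" by auto
    then show "card {y \<in> A. y \<le> x} \<in> {1..card A}"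
      using assms by (auto simp: Suc_le_eq card_gt_0_iff intro: card_mono)
  qed
  moreover have "card ((\<lambda>x. card {y \<in> A. y \<le> x}) ` A) = card A"
    using inj_on_card_le[OF assms] by (rule card_image)
  ultimately have "(\<lambda>x. card {y \<in> A. y \<le> x}) ` A = {1..card A}"
    by (intro card_subset_eq) auto
  then show ?thesis using inj_on_card_le[OF assms] by (auto simp: bij_betw_def)
qed

lemma standardise_in_decks:
  assumes "distinct w"
  shows "standardise w \<in> decks (length w)"
  using bij_betw_card_le[of "set w"] assms
  by (simp add: decks_def standardise_def bij_betw_def distinct_map distinct_card)

lemma standardise_decks:
  assumes "w \<in> decks n"
  shows "standardise w = w"
proof -
  have "card {y \<in> set w. y \<le> x} = x" if "x \<in> set w" for x
  proof -
    have "{y \<in> set w. y \<le> x} = {1..x}" using that assms by (auto simp: decks_def)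
    then show ?thesis by simp
  qed
  then show ?thesis by (simp add: standardise_def map_idI)
qed

text \<open>The rank map of the whole deck is an order embedding, so it does not disturb the
  relative order of a part of the deck.\<close>

lemma standardise_bottommost_standardise:
  "standardise (bottommost k (standardise w)) = standardise (bottommost k w)"
proof -
  have sub: "set (bottommost k w) \<subseteq> set w"
    by (simp add: bottommost_def set_drop_subset)
  define \<rho> where "\<rho> x = card {y \<in> set w. y \<le> x}" for x
  have "bottommost k (standardise w) = map \<rho> (bottommost k w)"
    by (simp add: standardise_def \<rho>_def bottommost_def drop_map)
  moreover have "standardise (map \<rho> (bottommost k w)) = standardise (map id (bottommost k w))"
    using inj_on_card_le[of "set w"] card_le_iff[of "set w"] sub
    by (intro standardise_map_cong) (auto simp: \<rho>_def[abs_def] intro: inj_on_subset)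
  ultimately show ?thesis by simp
qed

section \<open>Promoting values\<close>

text \<open>Sorting by \<open>key xs\<close> puts the entries of \<open>xs\<close> first, in the order of \<open>xs\<close>, and all other
  numbers after them in increasing order.\<close>

primrec key :: "nat list \<Rightarrow> nat \<Rightarrow> nat" where
  "key [] x = x"
| "key (a # xs) x = (if x = a then 0 else Suc (key xs x))"

lemma key_eq_iff: "key xs x = key xs y \<longleftrightarrow> x = y"
  by (induction xs) auto

lemma inj_key: "inj_on (key xs) A"
  by (simp add: inj_on_def key_eq_iff)

text \<open>An entry of \<open>xs\<close> outside \<open>B\<close> raises the keys of all elements
  of \<open>B\<close> by one, so deleting it changes no comparison inside \<open>B\<close>. The
  remaining entries are carried along by the order embedding \<beta>.\<close>

lemma key_map_filter:
  assumes "inj_on \<beta> B" "\<And>x y. x \<in> B \<Longrightarrow> y \<in> B \<Longrightarrow> \<beta> x \<le> \<beta> y \<longleftrightarrow> x \<le> y" "x \<in> B" "y \<in> B"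
  shows "key (map \<beta> (filter (\<lambda>x. x \<in> B) xs)) (\<beta> x) \<le> key (map \<beta> (filter (\<lambda>x. x \<in> B) xs)) (\<beta> y)
    \<longleftrightarrow> key xs x \<le> key xs y"
  using assms by (induction xs) (auto simp: inj_on_eq_iff)

text \<open>One step of the relabelling chain \<open>V\<close>: positions stay, and each value is
  replaced by its rank with respect to \<open>key xs\<close> for a random \<open>xs\<close>.\<close>

definition promote :: "nat list pmf \<Rightarrow> nat list \<Rightarrow> nat list pmf" where
  "promote X u = map_pmf (\<lambda>xs. standardise (map (key xs) u)) X"

lemma standardise_key_in_decks:
  assumes "u \<in> decks n"
  shows "standardise (map (key xs) u) \<in> decks n"
  using standardise_in_decks[of "map (key xs) u"] length_decks[OF assms] assms
  by (simp add: distinct_map inj_key decks_def)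

lemma set_promote: "u \<in> decks n \<Longrightarrow> set_pmf (promote X u) \<subseteq> decks n"
  by (auto simp: promote_def standardise_key_in_decks)

text \<open>For fixed \<open>xs\<close> a promotion applies one injective relabelling to all cards,
  and \<open>K\<close> commutes with relabellings by \<open>equiv\<close>. The list
  \<open>xs\<close> and the randomness of \<open>K\<close> are drawn independently, so the order of
  the two draws is irrelevant.\<close>

lemma promote_commute:
  assumes u: "u \<in> decks n"
    and inv: "\<And>w. w \<in> decks n \<Longrightarrow> set_pmf (K w) \<subseteq> decks n"
    and equiv: "\<And>f w. w \<in> decks n \<Longrightarrow> inj_on f {1..n} \<Longrightarrow> K (map f w) = map_pmf (map f) (K w)"
  shows "bind_pmf (promote X u) K = bind_pmf (K u) (promote X)"
proof -
  \<comment> \<open>Every deck in \<open>decks n\<close> has the value set \<open>{1..n}\<close>, so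
    the same relabelling \<open>f xs\<close> describes the promotion before and after the
    shuffle.\<close>
  define f where "f xs x = card {y \<in> {1..n}. key xs y \<le> key xs x}" for xs x
  have std: "standardise (map (key xs) w) = map (f xs) w" if "w \<in> decks n" for xs w
    using that by (simp add: standardise_map inj_key f_def decks_def)
  have inj: "inj_on (f xs) {1..n}" for xs
    using standardise_key_in_decks[OF u, of xs] u
    unfolding std[OF u] by (auto simp: decks_def distinct_map)
  have "bind_pmf (promote X u) K = bind_pmf X (\<lambda>xs. K (map (f xs) u))"
    by (simp add: promote_def bind_map_pmf std[OF u])
  also have "\<dots> = bind_pmf X (\<lambda>xs. bind_pmf (K u) (\<lambda>v. return_pmf (map (f xs) v)))"
    by (simp add: equiv[OF u inj] map_pmf_def)
  also have "\<dots> = bind_pmf (K u) (\<lambda>v. bind_pmf X (\<lambda>xs. return_pmf (map (f xs) v)))"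
    by (rule bind_commute_pmf)
  also have "\<dots> = bind_pmf (K u) (promote X)"
    using inv[OF u] std by (intro bind_pmf_cong) (auto simp: promote_def map_pmf_def)
  finally show ?thesis .
qed

lemma run_chain_eq_promote:
  assumes inv: "\<And>w. w \<in> decks n \<Longrightarrow> set_pmf (K w) \<subseteq> decks n"
    and equiv: "\<And>f w. w \<in> decks n \<Longrightarrow> inj_on f {1..n} \<Longrightarrow> K (map f w) = map_pmf (map f) (K w)"
    and start: "K [1..<n + 1] = promote X [1..<n + 1]"
  shows "run_chain K t [1..<n + 1] = run_chain (promote X) t [1..<n + 1]"
proof (rule run_chain_eq_of_commute[where S = "decks n"])
  fix y assume "y \<in> decks n"
  then show "set_pmf (promote X y) \<subseteq> decks n" by (rule set_promote)
next
  fix y assume "y \<in> decks n"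
  then show "bind_pmf (promote X y) K = bind_pmf (K y) (promote X)"
    using inv equiv by (rule promote_commute)
qed (use start identity_in_decks in auto)

lemma bottommost_decks:
  assumes "u \<in> decks n" "k \<le> n"
  shows "distinct (bottommost k u)" "length (bottommost k u) = k"
    "set (bottommost k u) \<subseteq> {1..n}" "card (set (bottommost k u)) = k"
proof -
  show d: "distinct (bottommost k u)" and l: "length (bottommost k u) = k"
    using assms length_decks[OF assms(1)] by (auto simp: bottommost_def decks_def)
  show "set (bottommost k u) \<subseteq> {1..n}"
    using assms by (auto simp: bottommost_def decks_def dest: in_set_dropD)
  show "card (set (bottommost k u)) = k"
    using d l by (simp add: distinct_card)
qed

text \<open>The new relative order of the bottom \<open>k\<close> cards depends on \<open>xs\<close>
  only through its entries among the values \<open>B\<close> of these cards, read as ranks in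
  \<open>B\<close>. By \<open>X\<close> the law of this reduced list is \<open>Y\<close> whatever
  \<open>B\<close> is, and this makes the projection a lumping.\<close>

lemma promote_lump:
  assumes u: "u \<in> decks n" and k: "k \<le> n"
    and X: "\<And>B \<beta>. B \<subseteq> {1..n} \<Longrightarrow> bij_betw \<beta> B {1..k} \<Longrightarrow>
      map_pmf (\<lambda>xs. map \<beta> (filter (\<lambda>x. x \<in> B) xs)) X = Y"
  shows "map_pmf (\<lambda>w. standardise (bottommost k w)) (promote X u)
    = promote Y (standardise (bottommost k u))"
proof -
  define B where "B = set (bottommost k u)"
  define \<beta> where "\<beta> x = card {y \<in> B. y \<le> x}" for x
  have bij: "bij_betw \<beta> B {1..k}"
    using bij_betw_card_le[of B] bottommost_decks[OF u k] by (simp add: B_def \<beta>_def[abs_def])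
  have inj: "inj_on \<beta> B" using bij by (simp add: bij_betw_def)
  have mono: "\<beta> x \<le> \<beta> y \<longleftrightarrow> x \<le> y" if "x \<in> B" "y \<in> B" for x y
    unfolding \<beta>_def using that by (intro card_le_iff) (auto simp: B_def)
  have std: "standardise (bottommost k u) = map \<beta> (bottommost k u)"
    by (simp add: standardise_def \<beta>_def B_def)
  have "standardise (bottommost k (standardise (map (key xs) u)))
      = standardise (map (key (map \<beta> (filter (\<lambda>x. x \<in> B) xs))) (standardise (bottommost k u)))"
    for xs
  proof -
    let ?ys = "map \<beta> (filter (\<lambda>x. x \<in> B) xs)"
    have "standardise (bottommost k (standardise (map (key xs) u)))
        = standardise (map (key xs) (bottommost k u))"
      by (simp add: standardise_bottommost_standardise) (simp add: bottommost_def drop_map)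
    \<comment> \<open>On \<open>B\<close> the keys for \<open>xs\<close> and the keys for the
      reduced list, taken at the ranks, give the same comparisons.\<close>
    also have "\<dots> = standardise (map (key ?ys \<circ> \<beta>) (bottommost k u))"
      using key_map_filter[OF inj mono] inj
      by (intro standardise_map_cong inj_key comp_inj_on) (auto simp: B_def)
    finally show ?thesis by (simp add: std)
  qed
  then have "map_pmf (\<lambda>w. standardise (bottommost k w)) (promote X u)
      = map_pmf (\<lambda>ys. standardise (map (key ys) (standardise (bottommost k u))))
          (map_pmf (\<lambda>xs. map \<beta> (filter (\<lambda>x. x \<in> B) xs)) X)"
    by (simp add: promote_def map_pmf_comp)
  also have "\<dots> = promote Y (standardise (bottommost k u))"
    using X[OF _ bij] bottommost_decks[OF u k] by (simp add: promote_def B_def)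
  finally show ?thesis .
qed

text \<open>The bottom \<open>k\<close> cards of the identity deck are a translate of
  \<open>1, ..., k\<close> by \<open>n - k\<close>, so the lumped chain also starts at the
  identity.\<close>

lemma standardise_bottommost_identity:
  assumes "k \<le> n"
  shows "standardise (bottommost k [1..<n + 1]) = [1..<k + 1]"
proof -
  have "bottommost k [1..<n + 1] = map (\<lambda>x. x + (n - k)) [1..<k + 1]"
  proof (rule nth_equalityI)
    show len: "length (bottommost k [1..<n + 1]) = length (map (\<lambda>x. x + (n - k)) [1..<k + 1])"
      using assms by (simp add: bottommost_def del: upt_Suc)
    fix i assume "i < length (bottommost k [1..<n + 1])"
    with len have "i < k" by (simp del: upt_Suc)
    then show "bottommost k [1..<n + 1] ! i = map (\<lambda>x. x + (n - k)) [1..<k + 1] ! i"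
      using assms by (simp add: bottommost_def del: upt_Suc)
  qed
  moreover have "standardise (map (\<lambda>x. x + (n - k)) [1..<k + 1]) = standardise (map id [1..<k + 1])"
    by (rule standardise_map_cong) (simp_all add: inj_on_def del: upt_Suc)
  ultimately show ?thesis
    using standardise_decks[OF identity_in_decks, of k] by (simp del: upt_Suc)
qed

text \<open>The common skeleton of both claims: replace \<open>K\<close> by promotions on
  \<open>n\<close> cards, lump to promotions on \<open>k\<close> cards, and replace these by
  \<open>L\<close>. What remains for each shuffle is to find \<open>X\<close> and \<open>Y\<close>
  and to check the restriction property \<open>X\<close>.\<close>

lemma run_chain_bottommost:
  assumes k: "k \<le> n"
    and "\<And>w. w \<in> decks n \<Longrightarrow> set_pmf (K w) \<subseteq> decks n"
    and "\<And>f w. w \<in> decks n \<Longrightarrow> inj_on f {1..n} \<Longrightarrow> K (map f w) = map_pmf (map f) (K w)"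
    and "K [1..<n + 1] = promote X [1..<n + 1]"
    and "\<And>w. w \<in> decks k \<Longrightarrow> set_pmf (L w) \<subseteq> decks k"
    and "\<And>f w. w \<in> decks k \<Longrightarrow> inj_on f {1..k} \<Longrightarrow> L (map f w) = map_pmf (map f) (L w)"
    and "L [1..<k + 1] = promote Y [1..<k + 1]"
    and X: "\<And>B \<beta>. B \<subseteq> {1..n} \<Longrightarrow> bij_betw \<beta> B {1..k} \<Longrightarrow>
      map_pmf (\<lambda>xs. map \<beta> (filter (\<lambda>x. x \<in> B) xs)) X = Y"
  shows "map_pmf (\<lambda>w. standardise (bottommost k w)) (run_chain K t [1..<n + 1])
    = run_chain L t [1..<k + 1]"
proof -
  have "run_chain K t [1..<n + 1] = run_chain (promote X) t [1..<n + 1]"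
    using assms(2-4) by (rule run_chain_eq_promote)
  moreover have "run_chain L t [1..<k + 1] = run_chain (promote Y) t [1..<k + 1]"
    using assms(5-7) by (rule run_chain_eq_promote)
  moreover have "map_pmf (\<lambda>w. standardise (bottommost k w)) (run_chain (promote X) t [1..<n + 1])
      = run_chain (promote Y) t (standardise (bottommost k [1..<n + 1]))"
    using set_promote identity_in_decks promote_lump[OF _ k X]
    by (intro map_pmf_run_chain[where S = "decks n"]) auto
  ultimately show ?thesis
    by (simp only: standardise_bottommost_identity[OF k])
qed

section \<open>Top-to-random\<close>

lemma set_top_to_random:
  assumes "w \<in> decks n" "0 < n"
  shows "set_pmf (top_to_random w) \<subseteq> decks n"
proof
  fix v assume "v \<in> set_pmf (top_to_random w)"
  moreover have "{..<length w} \<noteq> {}"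
    using assms length_decks by auto
  ultimately obtain i where v: "v = take i (tl w) @ hd w # drop i (tl w)"
    by (auto simp: top_to_random_def)
  have "mset v = add_mset (hd w) (mset (take i (tl w) @ drop i (tl w)))"
    unfolding v by (simp del: append_take_drop_id)
  also have "\<dots> = mset (hd w # tl w)"
    by (simp only: append_take_drop_id mset.simps)
  also have "hd w # tl w = w"
    using assms length_decks by (intro hd_Cons_tl) auto
  finally show "v \<in> decks n"
    using assms decks_mset_eq by blast
qed

lemma top_to_random_map:
  assumes "w \<noteq> []"
  shows "top_to_random (map f w) = map_pmf (map f) (top_to_random w)"
  using assms
  by (simp add: top_to_random_def map_pmf_comp hd_map take_map drop_map flip: map_tl)

text \<open>Reinserting card 1 below \<open>i\<close> other cards puts value 1 at position
  \<open>i + 1\<close> and raises the values above it by one. In terms of values, this is the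
  promotion of \<open>i + 1\<close>.\<close>

lemma top_to_random_identity:
  assumes "0 < n"
  shows "top_to_random [1..<n + 1]
    = promote (map_pmf (\<lambda>i. [i]) (pmf_of_set {1..n})) [1..<n + 1]"
proof -
  have std: "standardise (map (key [Suc i]) [1..<n + 1])
      = take i (tl [1..<n + 1]) @ hd [1..<n + 1] # drop i (tl [1..<n + 1])" (is "_ = ?v")
    if "i < n" for i
  proof -
    \<comment> \<open>On \<open>{1..n}\<close> this is the rank with respect to
      \<open>key [Suc i]\<close> in closed form, so that the relabelled deck can be computed
      explicitly.\<close>
    define h where "h x = (if x = Suc i then 1 else if x \<le> i then Suc x else x)" for x
    have "tl [1..<n + 1] = [2..<n + 1]" "hd [1..<n + 1] = 1"
      using assms by (simp_all add: upt_conv_Cons numeral_2_eq_2 del: upt_Suc)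
    then have v: "?v = [2..<i + 2] @ 1 # [i + 2..<n + 1]"
      using that by (simp add: add.commute del: upt_Suc)
    have "[1..<n + 1] = [1..<i + 1] @ [i + 1..<n + 1]"
      using that upt_add_eq_append[of 1 "i + 1" "n - i"] by (simp del: upt_Suc)
    also have "\<dots> = [1..<i + 1] @ (i + 1) # [i + 2..<n + 1]"
      using that by (simp add: upt_conv_Cons del: upt_Suc)
    finally have "map h [1..<n + 1] = map h [1..<i + 1] @ h (i + 1) # map h [i + 2..<n + 1]"
      by (simp only: map_append list.map)
    also have "map h [1..<i + 1] = map Suc [1..<i + 1]"
      by (intro map_cong refl) (auto simp: h_def)
    also have "map h [i + 2..<n + 1] = [i + 2..<n + 1]"
      by (intro map_idI) (auto simp: h_def)
    also have "h (i + 1) = 1"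
      by (simp add: h_def)
    finally have h: "map h [1..<n + 1] = ?v"
      unfolding v by (simp add: map_Suc_upt numeral_2_eq_2 del: upt_Suc)
    have decks: "?v \<in> decks n"
      unfolding v decks_def using that by auto
    then have "inj_on h (set [1..<n + 1])"
      unfolding h[symmetric] by (simp only: decks_def distinct_map mem_Collect_eq)
    then have "standardise (map (key [Suc i]) [1..<n + 1]) = standardise (map h [1..<n + 1])"
      by (rule standardise_map_cong[OF inj_key]) (auto simp: h_def)
    with h decks show ?thesis by (simp only: standardise_decks)
  qed
  \<comment> \<open>Insertion indices run from 0 to \<open>n - 1\<close> and promoted values from 1
    to \<open>n\<close>.\<close>
  have shift: "pmf_of_set {1..n} = map_pmf Suc (pmf_of_set {..<n})"
    using assms by (subst map_pmf_of_set_inj) (auto simp: image_Suc_lessThan)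
  have "set_pmf (pmf_of_set {..<n}) = {..<n}"
    using assms by (intro set_pmf_of_set) auto
  moreover have "{..<length [1..<n + 1]} = {..<n}"
    by (simp del: upt_Suc)
  ultimately show ?thesis
    unfolding top_to_random_def promote_def shift map_pmf_comp
    by (intro map_pmf_cong) (simp_all only: std lessThan_iff)
qed

text \<open>Staying put is the promotion of the empty list, because \<open>key []\<close> is the
  identity.\<close>

lemma lazy_chain_identity:
  assumes "0 < k"
  shows "lazy_chain \<alpha> top_to_random [1..<k + 1]
    = promote (bind_pmf (bernoulli_pmf \<alpha>) (\<lambda>stay. if stay then return_pmf []
        else map_pmf (\<lambda>i. [i]) (pmf_of_set {1..k}))) [1..<k + 1]"
proof -
  have "standardise (map (key []) [1..<k + 1]) = [1..<k + 1]"
    using standardise_decks[OF identity_in_decks, of k] by (simp add: map_idI del: upt_Suc)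
  then show ?thesis
    unfolding lazy_chain_def promote_def map_bind_pmf top_to_random_identity[OF assms]
    by (intro bind_pmf_cong refl) (simp del: upt_Suc)
qed

lemma set_lazy_chain:
  assumes "x \<in> S" "set_pmf (K x) \<subseteq> S"
  shows "set_pmf (lazy_chain \<alpha> K x) \<subseteq> S"
  using assms by (auto simp: lazy_chain_def split: if_splits)

lemma lazy_chain_map:
  assumes "K (f x) = map_pmf f (K x)"
  shows "lazy_chain \<alpha> K (f x) = map_pmf f (lazy_chain \<alpha> K x)"
  using assms by (auto simp: lazy_chain_def map_bind_pmf intro!: bind_pmf_cong)

text \<open>A uniform value of \<open>{1..n}\<close> falls into \<open>B\<close> with probability
  \<open>k / n\<close> and is then uniform on \<open>B\<close>; otherwise nothing survives the
  filter. This is where the laziness of the small chain comes from. The masses are compared by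
  counting preimages.\<close>

lemma uniform_singleton_restrict:
  assumes B: "B \<subseteq> {1..n}" and \<beta>: "bij_betw \<beta> B {1..k}" and "0 < k" "k \<le> n"
  shows "map_pmf (\<lambda>xs. map \<beta> (filter (\<lambda>x. x \<in> B) xs)) (map_pmf (\<lambda>i. [i]) (pmf_of_set {1..n}))
    = bind_pmf (bernoulli_pmf ((real n - real k) / real n)) (\<lambda>stay. if stay then return_pmf []
        else map_pmf (\<lambda>i. [i]) (pmf_of_set {1..k}))"
proof -
  have fin: "finite B" using B finite_subset by auto
  have cB: "card B = k" using bij_betw_same_card[OF \<beta>] by simp
  have k0: "pmf (map_pmf (\<lambda>i. [i]) (pmf_of_set {1..k})) [] = 0"
    by (auto simp: pmf_eq_0_set_pmf)
  have k1: "pmf (map_pmf (\<lambda>i. [i]) (pmf_of_set {1..k})) [j] = of_bool (j \<in> {1..k}) / k" for j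
    using assms(3) by (subst pmf_map_inj') (auto simp: inj_on_def indicator_def)
  have k2: "pmf (map_pmf (\<lambda>i. [i]) (pmf_of_set {1..k})) (a # b # zs) = 0" for a b zs
    by (auto simp: pmf_eq_0_set_pmf)
  let ?f = "\<lambda>i. if i \<in> B then [\<beta> i] else []"
  have lhs: "map_pmf (\<lambda>xs. map \<beta> (filter (\<lambda>x. x \<in> B) xs)) (map_pmf (\<lambda>i. [i]) (pmf_of_set {1..n}))
      = map_pmf ?f (pmf_of_set {1..n})"
    by (auto simp: map_pmf_comp intro!: map_pmf_cong)
  have pre: "pmf (map_pmf ?f (pmf_of_set {1..n})) ys = card ({1..n} \<inter> ?f -` {ys}) / n" for ys
    using assms(3,4) by (simp add: pmf_map measure_pmf_of_set)
  have pre0: "card ({1..n} \<inter> ?f -` {[]}) = n - k"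
  proof -
    have "{1..n} \<inter> ?f -` {[]} = {1..n} - B" by (auto split: if_splits)
    then show ?thesis using B fin cB by (simp add: card_Diff_subset)
  qed
  have pre1: "card ({1..n} \<inter> ?f -` {[j]}) = of_bool (j \<in> {1..k})" for j
  proof (cases "j \<in> {1..k}")
    case True
    then obtain i where i: "i \<in> B" "j = \<beta> i" using \<beta> unfolding bij_betw_def by blast
    then have "{1..n} \<inter> ?f -` {[j]} = {i}"
      using \<beta> B by (auto simp: bij_betw_def inj_on_def split: if_splits)
    with True show ?thesis by simp
  next
    case False
    then have "{1..n} \<inter> ?f -` {[j]} = {}" using \<beta> by (auto simp: bij_betw_def split: if_splits)
    with False show ?thesis by (simp only: card.empty of_bool_eq if_False)
  qed
  have pre2: "{1..n} \<inter> ?f -` {a # b # zs} = {}" for a b zs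
    by (auto split: if_splits)
  show ?thesis
    unfolding lhs
  proof (rule pmf_eqI)
    fix ys :: "nat list"
    have p: "0 \<le> (real n - real k) / real n" "(real n - real k) / real n \<le> 1"
      using assms(3,4) by (auto simp: field_simps)
    let ?R = "bind_pmf (bernoulli_pmf ((real n - real k) / real n)) (\<lambda>stay. if stay then return_pmf []
          else map_pmf (\<lambda>i. [i]) (pmf_of_set {1..k}))"
    have rhs: "pmf ?R ys = (real n - real k) / real n * of_bool (ys = [])
        + k / n * pmf (map_pmf (\<lambda>i. [i]) (pmf_of_set {1..k})) ys"
      using p assms(3,4) by (auto simp: pmf_bind field_simps)
    have "real (card ({1..n} \<inter> ?f -` {ys})) / real n = (real n - real k) / real n * of_bool (ys = [])
        + real k / real n * pmf (map_pmf (\<lambda>i. [i]) (pmf_of_set {1..k})) ys"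
    proof -
      \<comment> \<open>The rule \<open>remdups_adj.cases\<close> serves only to split lists by
        length 0, 1 and at least 2.\<close>
      consider "ys = []" | j where "ys = [j]" | a b zs where "ys = a # b # zs"
        by (cases ys rule: remdups_adj.cases) auto
      then show ?thesis
      proof cases
        case 1
        show ?thesis unfolding 1 pre0 k0 using assms(4) by simp
      next
        case 2
        show ?thesis unfolding 2 pre1 k1 using assms(3) by simp
      next
        case 3
        show ?thesis unfolding 3 pre2 k2 by simp
      qed
    qed
    then show "pmf (map_pmf ?f (pmf_of_set {1..n})) ys = pmf ?R ys"
      unfolding pre rhs .
  qed
qed

section \<open>Binomial-top-to-random\<close>

lemma set_binomial_pmf_subset: "p \<in> {0..1} \<Longrightarrow> set_pmf (binomial_pmf n p) \<subseteq> {..n}"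
  by (auto simp: set_pmf_binomial_eq split: if_splits)

lemma reorderings_nonempty: "w \<in> {v. mset v = mset w \<and> subseq (drop r w) v}"
  by (simp add: suffix_drop suffix_imp_subseq)

lemma finite_reorderings: "finite {v. mset v = mset w \<and> subseq (drop r w) v}"
  by (rule finite_subset[OF _ finite_lists_length_eq[of "set w" "length w"]])
    (auto dest: mset_eq_setD mset_eq_length)

lemma set_binomial_top_to_random:
  assumes "w \<in> decks n"
  shows "set_pmf (binomial_top_to_random q w) \<subseteq> decks n"
proof -
  have "set_pmf (pmf_of_set {v. mset v = mset w \<and> subseq (drop r w) v}) \<subseteq> decks n" for r
    using reorderings_nonempty[of w r] finite_reorderings[of w r] decks_mset_eq[OF assms]
    by (subst set_pmf_of_set) auto
  then show ?thesis by (auto simp: binomial_top_to_random_def)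
qed

text \<open>Relabelling by \<open>f\<close> is a bijection between the admissible reorderings of
  \<open>w\<close> and those of \<open>map f w\<close>; its inverse relabels by the inverse of
  \<open>f\<close> on \<open>set w\<close>. Uniform laws therefore correspond for each
  \<open>r\<close>.\<close>

lemma binomial_top_to_random_map:
  assumes "inj_on f (set w)"
  shows "binomial_top_to_random q (map f w) = map_pmf (map f) (binomial_top_to_random q w)"
proof -
  have "pmf_of_set {v. mset v = mset (map f w) \<and> subseq (drop r (map f w)) v}
      = map_pmf (map f) (pmf_of_set {v. mset v = mset w \<and> subseq (drop r w) v})" for r
  proof -
    let ?h = "inv_into (set w) f"
    have h: "map ?h (map f u) = u" if "set u \<subseteq> set w" for u
      using assms that by (auto intro!: map_idI inv_into_f_f)
    have "bij_betw (map f) {v. mset v = mset w \<and> subseq (drop r w) v}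
        {v. mset v = mset (map f w) \<and> subseq (drop r (map f w)) v}"
    proof (rule bij_betw_byWitness[where f' = "map ?h"])
      show "\<forall>a\<in>{v. mset v = mset w \<and> subseq (drop r w) v}. map ?h (map f a) = a"
        using h mset_eq_setD by blast
      show "\<forall>a\<in>{v. mset v = mset (map f w) \<and> subseq (drop r (map f w)) v}. map f (map ?h a) = a"
      proof safe
        fix a assume "mset a = mset (map f w)"
        then have "set a = f ` set w" using mset_eq_setD by fastforce
        then show "map f (map ?h a) = a"
          unfolding map_map by (intro map_idI) (auto simp: f_inv_into_f)
      qed
      show "map f ` {v. mset v = mset w \<and> subseq (drop r w) v}
          \<subseteq> {v. mset v = mset (map f w) \<and> subseq (drop r (map f w)) v}"
        by (auto simp: drop_map intro: subseq_map)
      show "map ?h ` {v. mset v = mset (map f w) \<and> subseq (drop r (map f w)) v}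
          \<subseteq> {v. mset v = mset w \<and> subseq (drop r w) v}"
      proof safe
        fix v assume v: "mset v = mset (map f w)" "subseq (drop r (map f w)) v"
        have "mset (map ?h v) = mset (map ?h (map f w))"
          using v(1) by (simp only: mset_map)
        then show "mset (map ?h v) = mset w" by (simp only: h[OF order.refl])
        have "subseq (map ?h (map f (drop r w))) (map ?h v)"
          using v(2) by (intro subseq_map) (simp add: drop_map)
        then show "subseq (drop r w) (map ?h v)"
          by (simp only: h[OF set_drop_subset])
      qed
    qed
    then show ?thesis
      using reorderings_nonempty[of w r] finite_reorderings[of w r]
      by (intro map_pmf_of_set_bij_betw[symmetric]) auto
  qed
  then show ?thesis by (simp add: binomial_top_to_random_def map_bind_pmf)
qed

section \<open>Random ordered selections from a finite set\<close>

definition distinct_lists :: "'a set \<Rightarrow> nat \<Rightarrow> 'a list set" where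
  "distinct_lists A r = {xs. length xs = r \<and> distinct xs \<and> set xs \<subseteq> A}"

lemma finite_distinct_lists:
  assumes "finite A"
  shows "finite (distinct_lists A r)"
  by (rule finite_subset[OF _ finite_lists_length_eq[OF assms, of r]]) (auto simp: distinct_lists_def)

text \<open>The falling factorial is written with a binomial coefficient so that it cancels the
  coefficient in the binomial mass.\<close>

lemma card_distinct_lists:
  assumes "finite A" "r \<le> card A"
  shows "card (distinct_lists A r) = (card A choose r) * fact r"
proof -
  have "card (distinct_lists A r) * fact (card A - r) = fact (card A)"
    unfolding distinct_lists_def card_lists_distinct_length_eq[OF assms]
    by (metis diff_le_self Suc_eq_plus1 fact_div_fact dvd_div_mult_self fact_dvd)
  moreover have "fact r * fact (card A - r) * (card A choose r) = fact (card A)"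
    using assms(2) by (rule binomial_fact_lemma)
  ultimately have "card (distinct_lists A r) * fact (card A - r)
      = ((card A choose r) * fact r) * fact (card A - r)"
    by (simp add: ac_simps)
  then show ?thesis by simp
qed

lemma distinct_lists_nonempty:
  assumes "finite A" "r \<le> card A"
  shows "distinct_lists A r \<noteq> {}"
  using card_distinct_lists[OF assms] assms(2) by force

text \<open>For two-stage experiments whose outcome determines the first stage: below, a list
  determines its set of entries and its length.\<close>

lemma pmf_bind_unique:
  assumes "\<And>y. y \<in> set_pmf M \<Longrightarrow> y \<noteq> y0 \<Longrightarrow> pmf (f y) x = 0"
  shows "pmf (bind_pmf M f) x = pmf M y0 * pmf (f y0) x"
proof -
  have "pmf (bind_pmf M f) x = (\<integral>y. indicator {y0} y * pmf (f y0) x \<partial>measure_pmf M)"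
    unfolding pmf_bind using assms
    by (intro integral_cong_AE) (auto simp: AE_measure_pmf_iff indicator_def)
  also have "\<dots> = pmf M y0 * pmf (f y0) x"
    by (simp add: measure_pmf_single)
  finally show ?thesis .
qed

text \<open>A binomial number of values in random order, encoded by independent marks because these
  restrict to subsets without any computation.\<close>

definition marked_shuffle :: "real \<Rightarrow> 'a set \<Rightarrow> 'a list pmf" where
  "marked_shuffle p A = bind_pmf (Pi_pmf A False (\<lambda>_. bernoulli_pmf p))
     (\<lambda>b. pmf_of_set (permutations_of_set {x \<in> A. b x}))"

text \<open>Forgetting the marks outside \<open>B\<close> leaves independent marks on
  \<open>B\<close>, and a uniform ordering induces a uniform ordering on the elements that are
  kept.\<close>

lemma marked_shuffle_filter:
  assumes "finite A" "B \<subseteq> A"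
  shows "map_pmf (filter (\<lambda>x. x \<in> B)) (marked_shuffle p A) = marked_shuffle p B"
proof -
  have filter: "map_pmf (filter P) (pmf_of_set (permutations_of_set S))
      = pmf_of_set (permutations_of_set {x \<in> S. P x})" if "finite S" for P and S :: "'a set"
  proof -
    have "map_pmf (filter P) (pmf_of_set (permutations_of_set S))
        = map_pmf fst (map_pmf (partition P) (pmf_of_set (permutations_of_set S)))"
      by (simp add: map_pmf_comp o_def)
    then show ?thesis
      unfolding partition_random_permutations[OF that] by (simp add: map_fst_pair_pmf)
  qed
  \<comment> \<open>\<open>Pi_pmf_subset\<close> writes the marks on \<open>B\<close> as those on
    \<open>A\<close> reset to the default \<open>False\<close> outside \<open>B\<close>.\<close>
  have "{x \<in> {x \<in> A. b x}. x \<in> B} = {x \<in> B. if x \<in> B then b x else False}" for b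
    using assms(2) by auto
  then show ?thesis
    unfolding marked_shuffle_def map_bind_pmf Pi_pmf_subset[OF assms] bind_map_pmf
    using assms(1) by (subst filter) auto
qed

text \<open>A list of \<open>r\<close> distinct elements of \<open>A\<close> has mass
  \<open>p^r (1 - p)^(card A - r) / r!\<close> on both sides. On the left its entries must be
  exactly the marked elements, in one of \<open>r!\<close> orders; on the right the binomial
  coefficient cancels.\<close>

lemma marked_shuffle_conv_binomial:
  assumes A: "finite A" and p: "p \<in> {0..1}"
  shows "marked_shuffle p A
    = bind_pmf (binomial_pmf (card A) p) (\<lambda>r. pmf_of_set (distinct_lists A r))"
proof (rule pmf_eqI)
  fix xs :: "'a list"
  let ?r = "length xs" and ?S = "set xs"
  have pmf_lists: "pmf (pmf_of_set (distinct_lists A r)) xs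
      = of_bool (xs \<in> distinct_lists A r) / card (distinct_lists A r)"
    if "r \<in> set_pmf (binomial_pmf (card A) p)" for r
  proof -
    have "r \<le> card A" using that set_binomial_pmf_subset[OF p] by blast
    then show ?thesis
      using A by (subst pmf_of_set) (simp_all add: finite_distinct_lists distinct_lists_nonempty indicator_def)
  qed
  have pmf_perms: "pmf (pmf_of_set (permutations_of_set {x \<in> A. b x})) xs
      = of_bool ({x \<in> A. b x} = ?S \<and> distinct xs) / fact (card {x \<in> A. b x})" for b
  proof -
    have "xs \<in> permutations_of_set {x \<in> A. b x} \<longleftrightarrow> {x \<in> A. b x} = ?S \<and> distinct xs"
      by (auto simp: permutations_of_set_def)
    then show ?thesis using A by (subst pmf_of_set) (simp_all add: indicator_def)
  qed
  show "pmf (marked_shuffle p A) xs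
      = pmf (bind_pmf (binomial_pmf (card A) p) (\<lambda>r. pmf_of_set (distinct_lists A r))) xs"
  proof (cases "distinct xs \<and> ?S \<subseteq> A")
    case True
    then have r: "card ?S = ?r" "?r \<le> card A"
      using A distinct_card[of xs] card_mono[of A ?S] by auto
    have S: "{x \<in> A. x \<in> ?S} = ?S" using True by auto
    have "pmf (marked_shuffle p A) xs
        = pmf (Pi_pmf A False (\<lambda>_. bernoulli_pmf p)) (\<lambda>x. x \<in> ?S)
          * pmf (pmf_of_set (permutations_of_set {x \<in> A. x \<in> ?S})) xs"
      unfolding marked_shuffle_def
    proof (rule pmf_bind_unique)
      fix b assume b: "b \<in> set_pmf (Pi_pmf A False (\<lambda>_. bernoulli_pmf p))" "b \<noteq> (\<lambda>x. x \<in> ?S)"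
      \<comment> \<open>The default value outside \<open>A\<close> makes \<open>b\<close> determined
        by its marked set, so a different \<open>b\<close> marks a different set.\<close>
      have "b x = False" if "x \<notin> A" for x
        using b(1) that set_Pi_pmf_subset[OF A, of False "\<lambda>_. bernoulli_pmf p"] by blast
      then have "{x \<in> A. b x} \<noteq> ?S" using b(2) by auto
      then show "pmf (pmf_of_set (permutations_of_set {x \<in> A. b x})) xs = 0"
        unfolding pmf_perms by simp
    qed
    also have "pmf (Pi_pmf A False (\<lambda>_. bernoulli_pmf p)) (\<lambda>x. x \<in> ?S)
        = (\<Prod>x\<in>A. if x \<in> ?S then p else 1 - p)"
      using True p A by (subst pmf_Pi') (auto intro!: prod.cong)
    also have "\<dots> = p ^ ?r * (1 - p) ^ (card A - ?r)"
    proof -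
      have "A \<inter> {x. x \<in> ?S} = ?S" "A \<inter> - {x. x \<in> ?S} = A - ?S" using True by auto
      then show ?thesis using A True r by (subst prod.If_cases) (auto simp: card_Diff_subset)
    qed
    finally have lhs: "pmf (marked_shuffle p A) xs
        = p ^ ?r * (1 - p) ^ (card A - ?r) / fact ?r"
      unfolding pmf_perms unfolding S using True r by simp
    have "pmf (bind_pmf (binomial_pmf (card A) p) (\<lambda>r. pmf_of_set (distinct_lists A r))) xs
        = pmf (binomial_pmf (card A) p) ?r * pmf (pmf_of_set (distinct_lists A ?r)) xs"
    proof (rule pmf_bind_unique)
      fix r assume "r \<in> set_pmf (binomial_pmf (card A) p)" "r \<noteq> ?r"
      then show "pmf (pmf_of_set (distinct_lists A r)) xs = 0"
        unfolding pmf_lists[OF \<open>r \<in> _\<close>] by (simp add: distinct_lists_def)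
    qed
    also have "\<dots> = (card A choose ?r) * p ^ ?r * (1 - p) ^ (card A - ?r)
        / card (distinct_lists A ?r)"
    proof -
      have "xs \<in> distinct_lists A ?r" using True by (simp add: distinct_lists_def)
      then show ?thesis
        using p r A by (subst pmf_of_set) (auto simp: finite_distinct_lists)
    qed
    also have "\<dots> = p ^ ?r * (1 - p) ^ (card A - ?r) / fact ?r"
      using r by (simp add: card_distinct_lists[OF A r(2)])
    finally show ?thesis unfolding lhs by simp
  next
    case False
    have "pmf (marked_shuffle p A) xs = 0"
    proof -
      have "pmf (pmf_of_set (permutations_of_set {x \<in> A. b x})) xs = 0" for b
        unfolding pmf_perms using False by auto
      then show ?thesis by (auto simp: marked_shuffle_def pmf_eq_0_set_pmf)
    qed
    moreover have "pmf (bind_pmf (binomial_pmf (card A) p) (\<lambda>r. pmf_of_set (distinct_lists A r))) xs = 0"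
    proof -
      have "pmf (pmf_of_set (distinct_lists A r)) xs = 0"
        if "r \<in> set_pmf (binomial_pmf (card A) p)" for r
        unfolding pmf_lists[OF that] using False by (simp add: distinct_lists_def)
      then show ?thesis by (auto simp: pmf_eq_0_set_pmf)
    qed
    ultimately show ?thesis by simp
  qed
qed

lemma bij_betw_distinct_lists:
  assumes "bij_betw \<beta> B C"
  shows "bij_betw (map \<beta>) (distinct_lists B r) (distinct_lists C r)"
proof -
  let ?\<gamma> = "inv_into B \<beta>"
  have \<gamma>: "bij_betw ?\<gamma> C B" using assms by (rule bij_betw_inv_into)
  have left: "?\<gamma> (\<beta> x) = x" if "x \<in> B" for x
    using assms that by (rule bij_betw_inv_into_left)
  have right: "\<beta> (?\<gamma> y) = y" if "y \<in> C" for y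
    using assms that by (rule bij_betw_inv_into_right)
  have image: "map f ` distinct_lists A r \<subseteq> distinct_lists A' r"
    if "bij_betw f A A'" for f :: "'c \<Rightarrow> 'd" and A A'
    using that by (fastforce simp: distinct_lists_def distinct_map bij_betw_def intro: inj_on_subset)
  show ?thesis
  proof (rule bij_betw_byWitness[where f' = "map ?\<gamma>"])
    show "\<forall>xs\<in>distinct_lists B r. map ?\<gamma> (map \<beta> xs) = xs"
      using left by (auto simp: distinct_lists_def intro!: map_idI)
    show "\<forall>ys\<in>distinct_lists C r. map \<beta> (map ?\<gamma> ys) = ys"
      using right by (auto simp: distinct_lists_def intro!: map_idI)
  qed (use image[OF assms] image[OF \<gamma>] in auto)
qed

text \<open>In the binomial form the number of entries depends only on the cardinality, and \<beta>
  maps the distinct lists of each length bijectively.\<close>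

lemma marked_shuffle_map:
  assumes "bij_betw \<beta> B C" "finite B" "p \<in> {0..1}"
  shows "map_pmf (map \<beta>) (marked_shuffle p B) = marked_shuffle p C"
proof -
  have "finite C" "card C = card B"
    using assms by (auto simp: bij_betw_finite bij_betw_same_card)
  moreover have "map_pmf (map \<beta>) (pmf_of_set (distinct_lists B r)) = pmf_of_set (distinct_lists C r)"
    if "r \<in> set_pmf (binomial_pmf (card B) p)" for r
    using that assms set_binomial_pmf_subset[OF assms(3)]
    by (intro map_pmf_of_set_bij_betw bij_betw_distinct_lists distinct_lists_nonempty
        finite_distinct_lists) auto
  ultimately show ?thesis
    using assms by (simp add: marked_shuffle_conv_binomial map_bind_pmf cong: bind_pmf_cong)
qed

section \<open>Promotions of the identity deck and reorderings that keep the lower cards in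
  order\<close>

lemma key_nth: "distinct xs \<Longrightarrow> j < length xs \<Longrightarrow> key xs (xs ! j) = j"
proof (induction xs arbitrary: j)
  case (Cons a xs)
  then show ?case by (cases j) auto
qed simp

lemma key_notin: "x \<notin> set xs \<Longrightarrow> key xs x = length xs + x"
  by (induction xs) auto

text \<open>On the identity deck, promoting \<open>xs\<close> puts value \<open>j + 1\<close> at position \<open>xs ! j\<close>.\<close>

lemma card_key_le_nth:
  assumes "distinct xs" "set xs \<subseteq> A" "j < length xs"
  shows "card {y \<in> A. key xs y \<le> key xs (xs ! j)} = Suc j"
proof -
  have "{y \<in> A. key xs y \<le> key xs (xs ! j)} = (!) xs ` {..j}"
  proof (intro set_eqI iffI)
    fix y assume y: "y \<in> {y \<in> A. key xs y \<le> key xs (xs ! j)}"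
    then have "key xs y \<le> j" using assms by (simp add: key_nth)
    moreover have "y \<in> set xs"
      using calculation assms(3) key_notin[of y xs] by (cases "y \<in> set xs") auto
    then obtain i where "i < length xs" "y = xs ! i" by (auto simp: in_set_conv_nth)
    ultimately show "y \<in> (!) xs ` {..j}" using assms by (auto simp: key_nth)
  next
    fix y assume "y \<in> (!) xs ` {..j}"
    then obtain i where "i \<le> j" "y = xs ! i" by auto
    then show "y \<in> {y \<in> A. key xs y \<le> key xs (xs ! j)}"
      using assms nth_mem[of i xs] by (auto simp: key_nth)
  qed
  moreover have "inj_on ((!) xs) {..j}"
    using assms by (intro inj_on_nth) auto
  ultimately show ?thesis by (simp add: card_image)
qed

text \<open>All entries of \<open>xs\<close>, and \<open>x\<close> itself, have keys at most that of
  \<open>x\<close>.\<close>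

lemma card_key_le_notin:
  assumes "finite A" "distinct xs" "set xs \<subseteq> A" "x \<in> A" "x \<notin> set xs"
  shows "length xs < card {y \<in> A. key xs y \<le> key xs x}"
proof -
  have "insert x (set xs) \<subseteq> {y \<in> A. key xs y \<le> key xs x}"
  proof
    fix y assume y: "y \<in> insert x (set xs)"
    show "y \<in> {y \<in> A. key xs y \<le> key xs x}"
    proof (cases "y = x")
      case False
      then obtain i where "i < length xs" "y = xs ! i"
        using y by (auto simp: in_set_conv_nth)
      then show ?thesis using assms by (auto simp: key_nth key_notin)
    qed (use assms in simp)
  qed
  then have "card (insert x (set xs)) \<le> card {y \<in> A. key xs y \<le> key xs x}"
    using assms(1) by (intro card_mono) auto
  then show ?thesis using assms by (simp add: distinct_card)
qed

text \<open>In a strictly sorted list the smaller of two entries comes first, so growth of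
  \<open>a\<close> along the list is growth of \<open>a\<close> as a function.\<close>

lemma sorted_wrt_less_strict_mono:
  fixes L :: "'a::linorder list"
  assumes "sorted_wrt (<) L" "sorted_wrt (\<lambda>x y. a x < (a y :: 'b::linorder)) L" "x \<in> set L" "y \<in> set L" "x < y"
  shows "a x < a y"
  using assms by (induction L) (auto dest: less_asym)

text \<open>A deck in which \<open>r + 1, ..., n\<close> keep their order is determined by the
  positions of the cards \<open>1, ..., r\<close>. Listed in the order of these cards, the positions
  form the list \<open>xs\<close> whose promotion produces the deck.\<close>

lemma bij_betw_promote:
  assumes r: "r \<le> n"
  shows "bij_betw (\<lambda>xs. standardise (map (key xs) [1..<n + 1])) (distinct_lists {1..n} r)
    {v. mset v = mset [1..<n + 1] \<and> subseq (drop r [1..<n + 1]) v}"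
proof -
  define id where "id = [1..<n + 1]"
  have set_id: "set id = {1..n}" by (auto simp: id_def)
  have drop_id: "drop r id = [r + 1..<n + 1]" by (simp add: id_def del: upt_Suc)
  \<comment> \<open>\<open>f xs x\<close> is the card at position \<open>x\<close> after promoting
    \<open>xs\<close> on the identity deck.\<close>
  define f where "f xs x = card {y \<in> {1..n}. key xs y \<le> key xs x}" for xs x
  have F: "standardise (map (key xs) id) = map (f xs) id" for xs
    by (simp add: standardise_map inj_key f_def set_id)
  have decks: "map (f xs) id \<in> decks n" for xs
    using standardise_key_in_decks[OF identity_in_decks[of n, folded id_def], of xs]
    by (simp add: F)
  have inj_f: "inj_on (f xs) {1..n}" for xs
    using decks[of xs] by (simp add: decks_def distinct_map set_id)
  have f_nth: "f xs (xs ! j) = Suc j" if "xs \<in> distinct_lists {1..n} r" "j < r" for xs j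
    unfolding f_def using that by (intro card_key_le_nth) (auto simp: distinct_lists_def)
  have f_notin: "r < f xs x" if "xs \<in> distinct_lists {1..n} r" "x \<in> {1..n}" "x \<notin> set xs" for xs x
    unfolding f_def using that card_key_le_notin[of "{1..n}" xs x] by (auto simp: distinct_lists_def)
  have f_less: "r < f xs x \<longleftrightarrow> x \<notin> set xs" if xs: "xs \<in> distinct_lists {1..n} r" and x: "x \<in> {1..n}" for xs x
  proof
    assume *: "r < f xs x"
    show "x \<notin> set xs"
    proof
      assume "x \<in> set xs"
      then obtain j where "j < r" "x = xs ! j"
        using xs by (auto simp: in_set_conv_nth distinct_lists_def)
      then show False using * f_nth[OF xs] by simp
    qed
  qed (use f_notin[OF xs x] in blast)
  \<comment> \<open>The entry \<open>xs ! j\<close> is recovered as the only position that carries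
    card \<open>j + 1\<close>.\<close>
  have "inj_on (\<lambda>xs. map (f xs) id) (distinct_lists {1..n} r)"
  proof (rule inj_onI)
    fix xs ys assume xs: "xs \<in> distinct_lists {1..n} r" and ys: "ys \<in> distinct_lists {1..n} r"
      and eq: "map (f xs) id = map (f ys) id"
    show "xs = ys"
    proof (rule nth_equalityI)
      show "length xs = length ys" using xs ys by (simp add: distinct_lists_def)
      fix j assume "j < length xs"
      then have j: "j < r" using xs by (simp add: distinct_lists_def)
      have mem: "xs ! j \<in> {1..n}" "ys ! j \<in> {1..n}"
        using xs ys j nth_mem[of j xs] nth_mem[of j ys]
        by (simp_all add: distinct_lists_def subset_iff)
      then have "f ys (xs ! j) = f xs (xs ! j)"
        using eq set_id by (metis map_eq_conv)
      also have "\<dots> = f ys (ys ! j)" using f_nth[OF xs j] f_nth[OF ys j] by simp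
      finally show "xs ! j = ys ! j" using inj_f mem by (meson inj_onD)
    qed
  qed
  moreover have "(\<lambda>xs. map (f xs) id) ` distinct_lists {1..n} r
      \<subseteq> {v. mset v = mset id \<and> subseq (drop r id) v}"
  proof safe
    fix xs assume xs: "xs \<in> distinct_lists {1..n} r"
    show "mset (map (f xs) id) = mset id"
      using decks[of xs] by (simp only: decks_conv_mset id_def)
    \<comment> \<open>The cards above \<open>r\<close> stand at the positions missing from
      \<open>xs\<close>. Keys increase with the position there, so these cards appear in increasing
      order and must be \<open>r + 1, ..., n\<close>.\<close>
    let ?L = "filter (\<lambda>x. x \<notin> set xs) id"
    have "filter (\<lambda>v. r < v) (map (f xs) id) = map (f xs) ?L"
      unfolding filter_map o_def using f_less[OF xs] set_id by (metis (mono_tags, lifting) filter_cong)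
    moreover have "sorted (map (f xs) ?L)"
    proof -
      have "sorted_wrt (\<lambda>x y. f xs x \<le> f xs y) ?L"
      proof (rule sorted_wrt_mono_rel)
        show "sorted_wrt (\<le>) ?L" by (intro sorted_wrt_filter) (simp add: id_def del: upt_Suc)
        fix x y assume "x \<in> set ?L" "y \<in> set ?L" "x \<le> y"
        then show "f xs x \<le> f xs y"
          unfolding f_def by (intro card_mono) (auto simp: key_notin)
      qed
      then show ?thesis by (simp add: sorted_wrt_map)
    qed
    moreover have "distinct (filter (\<lambda>v. r < v) (map (f xs) id))"
      using decks[of xs] unfolding decks_def by (intro distinct_filter) simp
    moreover have "set (filter (\<lambda>v. r < v) (map (f xs) id)) = set [r + 1..<n + 1]"
    proof -
      have "set (map (f xs) id) = {1..n}" using decks[of xs] by (simp add: decks_def)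
      then show ?thesis by auto
    qed
    ultimately have "filter (\<lambda>v. r < v) (map (f xs) id) = [r + 1..<n + 1]"
      by (intro sorted_distinct_set_unique) (simp_all del: upt_Suc)
    then show "subseq (drop r id) (map (f xs) id)"
      unfolding drop_id by (metis subseq_filter_left)
  qed
  moreover have "{v. mset v = mset id \<and> subseq (drop r id) v}
      \<subseteq> (\<lambda>xs. map (f xs) id) ` distinct_lists {1..n} r"
  proof safe
    fix v assume v: "mset v = mset id" "subseq (drop r id) v"
    then have vd: "v \<in> decks n" by (simp only: decks_conv_mset id_def)
    \<comment> \<open>\<open>a x\<close> is the card of \<open>v\<close> at position
      \<open>x\<close>, counted from 1, and its inverse \<open>c\<close> below gives the position of
      a card.\<close>
    define a where "a x = v ! (x - 1)" for x
    have va: "v = map a id"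
      using length_decks[OF vd] by (intro nth_equalityI) (auto simp: a_def id_def simp del: upt_Suc)
    then have bij: "bij_betw a {1..n} {1..n}"
      using vd set_id by (auto simp: decks_def distinct_map bij_betw_def)
    define c where "c = inv_into {1..n} a"
    have c: "bij_betw c {1..n} {1..n}"
      unfolding c_def using bij by (rule bij_betw_inv_into)
    have ca: "c (a x) = x" if "x \<in> {1..n}" for x
      unfolding c_def using bij that by (rule bij_betw_inv_into_left)
    have ac: "a (c x) = x" if "x \<in> {1..n}" for x
      unfolding c_def using bij that by (rule bij_betw_inv_into_right)
    have a_mem: "a x \<in> {1..n}" if "x \<in> {1..n}" for x
      using bij that by (auto simp: bij_betw_def)
    \<comment> \<open>The preimage of \<open>v\<close>: the positions of the cards
      \<open>1, ..., r\<close>, in this order.\<close>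
    define xs where "xs = map c [1..<r + 1]"
    have xs: "xs \<in> distinct_lists {1..n} r"
    proof -
      have "set [1..<r + 1] \<subseteq> {1..n}" using r by auto
      then have "inj_on c (set [1..<r + 1])" "c ` set [1..<r + 1] \<subseteq> {1..n}"
        using c unfolding bij_betw_def by (blast intro: inj_on_subset)+
      then show ?thesis
        unfolding xs_def distinct_lists_def by (simp add: distinct_map del: upt_Suc)
    qed
    have xs_iff: "x \<in> set xs \<longleftrightarrow> a x \<le> r" if x: "x \<in> {1..n}" for x
    proof
      assume "x \<in> set xs"
      then obtain i where "i \<in> set [1..<r + 1]" "x = c i" unfolding xs_def set_map by blast
      then show "a x \<le> r" using ac[of i] r by (auto simp del: upt_Suc)
    next
      assume "a x \<le> r"
      then have "a x \<in> set [1..<r + 1]" using a_mem[OF x] by auto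
      then have "c (a x) \<in> set xs" unfolding xs_def set_map by (rule imageI)
      then show "x \<in> set xs" using ca[OF x] by simp
    qed
    have key_in: "key xs x = a x - 1" if x: "x \<in> {1..n}" and "a x \<le> r" for x
    proof -
      have "a x - 1 < length [1..<r + 1]"
        using a_mem[OF x] that by (auto simp del: upt_Suc)
      then have "xs ! (a x - 1) = x" "a x - 1 < length xs"
        using a_mem[OF x] ca[OF x] by (simp_all add: xs_def del: upt_Suc)
      then show ?thesis using key_nth[of xs "a x - 1"] xs by (simp add: distinct_lists_def)
    qed
    have key_out: "key xs x = r + x" if "x \<in> {1..n}" "r < a x" for x
      using that xs_iff[of x] key_notin[of x xs] xs by (simp add: distinct_lists_def)
    let ?L = "filter (\<lambda>x. r < a x) id"
    \<comment> \<open>One list is a subsequence of the other and both have \<open>n - r\<close>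
      entries, so they are equal.\<close>
    have "filter (\<lambda>z. r < z) v = [r + 1..<n + 1]"
    proof -
      have "subseq (filter (\<lambda>z. r < z) [r + 1..<n + 1]) (filter (\<lambda>z. r < z) v)"
        using v(2) unfolding drop_id by (rule subseq_filter)
      moreover have "filter (\<lambda>z. r < z) [r + 1..<n + 1] = [r + 1..<n + 1]"
        by (intro filter_True) auto
      moreover have "length (filter (\<lambda>z. r < z) v) = length [r + 1..<n + 1]"
      proof -
        have "set (filter (\<lambda>z. r < z) v) = {r + 1..n}"
          using vd by (auto simp: decks_def)
        moreover have "distinct (filter (\<lambda>z. r < z) v)" using vd by (simp add: decks_def)
        ultimately have "length (filter (\<lambda>z. r < z) v) = card {r + 1..n}"
          using distinct_card by metis
        then show ?thesis by (simp del: upt_Suc)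
      qed
      ultimately show ?thesis using subseq_same_length by metis
    qed
    then have "map a ?L = [r + 1..<n + 1]" unfolding va filter_map o_def .
    then have "sorted_wrt (<) (map a ?L)" by (simp del: upt_Suc)
    then have "sorted_wrt (\<lambda>x y. a x < a y) ?L" by (simp add: sorted_wrt_map)
    moreover have "sorted_wrt (<) ?L"
      by (intro sorted_wrt_filter) (simp add: id_def del: upt_Suc)
    ultimately have mono: "a x < a y" if "x \<in> {1..n}" "y \<in> {1..n}" "r < a x" "r < a y" "x < y" for x y
      using that set_id by (intro sorted_wrt_less_strict_mono[of ?L a]) auto
    \<comment> \<open>Sorting positions by key is sorting them by card: the cards up to
      \<open>r\<close> have key \<open>a x - 1\<close>, below \<open>r\<close>, and the larger cards
      have key \<open>r + x\<close>, which grows with \<open>a x\<close> by \<open>mono\<close>.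
      Standardising therefore returns \<open>v\<close>.\<close>
    have le_iff: "key xs x \<le> key xs y \<longleftrightarrow> a x \<le> a y" if x: "x \<in> {1..n}" and y: "y \<in> {1..n}" for x y
    proof -
      have "a x \<le> a y \<longleftrightarrow> x \<le> y" if "r < a x" "r < a y"
        using that mono[OF x y] mono[OF y x] by (cases x y rule: linorder_cases) auto
      then show ?thesis
        using key_in[OF x] key_in[OF y] key_out[OF x] key_out[OF y] a_mem[OF x] a_mem[OF y]
        by (cases "a x \<le> r"; cases "a y \<le> r") auto
    qed
    have "map (f xs) id = standardise (map a id)"
      unfolding F[symmetric] using bij le_iff
      by (intro standardise_map_cong inj_key) (auto simp: set_id bij_betw_def)
    also have "\<dots> = v" using standardise_decks[OF vd] va by simp
    finally show "v \<in> (\<lambda>xs. map (f xs) id) ` distinct_lists {1..n} r"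
      using xs by blast
  qed
  ultimately show ?thesis
    unfolding bij_betw_def F[unfolded id_def] id_def by blast
qed

text \<open>For each \<open>r\<close> the bijection carries uniform distinct lists to uniform
  admissible reorderings; averaging over the binomial \<open>r\<close> gives the marked
  shuffle.\<close>

lemma binomial_top_to_random_identity:
  assumes "0 \<le> q" "q \<le> 1"
  shows "binomial_top_to_random q [1..<n + 1]
    = promote (marked_shuffle (1 - q) {1..n}) [1..<n + 1]"
proof -
  have p: "1 - q \<in> {0..1}" using assms by auto
  have "pmf_of_set {v. mset v = mset [1..<n + 1] \<and> subseq (drop r [1..<n + 1]) v}
      = map_pmf (\<lambda>xs. standardise (map (key xs) [1..<n + 1])) (pmf_of_set (distinct_lists {1..n} r))"
    if "r \<in> set_pmf (binomial_pmf n (1 - q))" for r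
  proof -
    have "r \<le> n" using that set_binomial_pmf_subset[OF p] by blast
    then show ?thesis
      by (intro map_pmf_of_set_bij_betw[symmetric] bij_betw_promote distinct_lists_nonempty
          finite_distinct_lists) auto
  qed
  moreover have "length [1..<n + 1] = n" "card {1..n} = n" by simp_all
  ultimately show ?thesis
    unfolding binomial_top_to_random_def promote_def
      marked_shuffle_conv_binomial[OF finite_atLeastAtMost p] map_bind_pmf
    by (intro bind_pmf_cong) (simp_all only:)
qed

theorem theorem6p3:
  fixes n k t :: nat and q2 :: real
  assumes "1 \<le> k" and "k \<le> n" and "0 \<le> q2" and "q2 \<le> 1"
  shows "map_pmf (\<lambda>w. standardise (bottommost k w)) (run_chain top_to_random t [1..<n + 1])
           = run_chain (lazy_chain ((real n - real k) / real n) top_to_random) t [1..<k + 1]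
       \<and> map_pmf (\<lambda>w. standardise (bottommost k w))
             (run_chain (binomial_top_to_random q2) t [1..<n + 1])
           = run_chain (binomial_top_to_random q2) t [1..<k + 1]"
proof
  have pos: "0 < k" "0 < n" using assms by auto
  have ttr: "top_to_random (map f w) = map_pmf (map f) (top_to_random w)"
    if "w \<in> decks m" "0 < m" for f :: "nat \<Rightarrow> nat" and w m
    using that length_decks by (intro top_to_random_map) auto
  let ?lazy = "lazy_chain ((real n - real k) / real n) top_to_random :: nat list \<Rightarrow> nat list pmf"
  show "map_pmf (\<lambda>w. standardise (bottommost k w)) (run_chain top_to_random t [1..<n + 1])
      = run_chain ?lazy t [1..<k + 1]"
  proof (rule run_chain_bottommost[OF \<open>k \<le> n\<close>])
    show "top_to_random [1..<n + 1]
        = promote (map_pmf (\<lambda>i. [i]) (pmf_of_set {1..n})) [1..<n + 1]"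
      using pos by (intro top_to_random_identity)
    show "?lazy [1..<k + 1] = promote (bind_pmf (bernoulli_pmf ((real n - real k) / real n))
        (\<lambda>stay. if stay then return_pmf [] else map_pmf (\<lambda>i. [i]) (pmf_of_set {1..k}))) [1..<k + 1]"
      using pos by (intro lazy_chain_identity)
    show "set_pmf (top_to_random w) \<subseteq> decks n" if "w \<in> decks n" for w
      using that pos by (intro set_top_to_random)
    show "set_pmf (?lazy w) \<subseteq> decks k" if "w \<in> decks k" for w
      using that pos by (intro set_lazy_chain set_top_to_random)
    show "top_to_random (map f w) = map_pmf (map f) (top_to_random w)"
      if "w \<in> decks n" for f :: "nat \<Rightarrow> nat" and w
      using that pos by (intro ttr)
    show "?lazy (map f w) = map_pmf (map f) (?lazy w)"
      if "w \<in> decks k" for f :: "nat \<Rightarrow> nat" and w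
      using that pos by (intro lazy_chain_map ttr)
    show "map_pmf (\<lambda>xs. map \<beta> (filter (\<lambda>x. x \<in> B) xs)) (map_pmf (\<lambda>i. [i]) (pmf_of_set {1..n}))
        = bind_pmf (bernoulli_pmf ((real n - real k) / real n))
            (\<lambda>stay. if stay then return_pmf [] else map_pmf (\<lambda>i. [i]) (pmf_of_set {1..k}))"
      if "B \<subseteq> {1..n}" "bij_betw \<beta> B {1..k}" for B \<beta>
      using that pos \<open>k \<le> n\<close> by (intro uniform_singleton_restrict)
  qed
  have p: "1 - q2 \<in> {0..1}" using assms by auto
  show "map_pmf (\<lambda>w. standardise (bottommost k w))
      (run_chain (binomial_top_to_random q2) t [1..<n + 1])
      = run_chain (binomial_top_to_random q2) t [1..<k + 1]"
  proof (rule run_chain_bottommost[OF \<open>k \<le> n\<close>])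
    show ident: "binomial_top_to_random q2 [1..<m + 1]
        = promote (marked_shuffle (1 - q2) {1..m}) [1..<m + 1]" for m
      using assms by (intro binomial_top_to_random_identity)
    then show "binomial_top_to_random q2 [1..<k + 1]
        = promote (marked_shuffle (1 - q2) {1..k}) [1..<k + 1]" .
    show inv: "set_pmf (binomial_top_to_random q2 w) \<subseteq> decks m" if "w \<in> decks m" for w m
      using that by (rule set_binomial_top_to_random)
    then show "set_pmf (binomial_top_to_random q2 w) \<subseteq> decks k" if "w \<in> decks k" for w
      using that .
    show equiv: "binomial_top_to_random q2 (map f w) = map_pmf (map f) (binomial_top_to_random q2 w)"
      if "w \<in> decks m" "inj_on f {1..m}" for f :: "nat \<Rightarrow> nat" and w m
      using that by (intro binomial_top_to_random_map) (simp add: decks_def)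
    then show "binomial_top_to_random q2 (map f w) = map_pmf (map f) (binomial_top_to_random q2 w)"
      if "w \<in> decks k" "inj_on f {1..k}" for f :: "nat \<Rightarrow> nat" and w
      using that .
    fix B :: "nat set" and \<beta> :: "nat \<Rightarrow> nat"
    assume B: "B \<subseteq> {1..n}" and \<beta>: "bij_betw \<beta> B {1..k}"
    \<comment> \<open>Filtering and relabelling are separated: the first uses the independence of
      the marks, the second only the bijection from \<open>B\<close> to
      \<open>{1..k}\<close>.\<close>
    have "map_pmf (\<lambda>xs. map \<beta> (filter (\<lambda>x. x \<in> B) xs)) (marked_shuffle (1 - q2) {1..n})
        = map_pmf (map \<beta>) (map_pmf (filter (\<lambda>x. x \<in> B)) (marked_shuffle (1 - q2) {1..n}))"
      by (simp add: map_pmf_comp)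
    also have "\<dots> = map_pmf (map \<beta>) (marked_shuffle (1 - q2) B)"
      using B by (simp add: marked_shuffle_filter)
    also have "\<dots> = marked_shuffle (1 - q2) {1..k}"
      using \<beta> p finite_subset[OF B] by (intro marked_shuffle_map) auto
    finally show "map_pmf (\<lambda>xs. map \<beta> (filter (\<lambda>x. x \<in> B) xs)) (marked_shuffle (1 - q2) {1..n})
        = marked_shuffle (1 - q2) {1..k}" .
  qed
qed

end
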